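(* Let $f\colon\mathbb{R}^n\to\mathbb{R}$ be continuously differentiable and convex, have a global minimizer, and have a Lipschitz continuous gradient with constant $L>0$, i.e. $\|\nabla f(x)-\nabla f(y)\|\le L\|x-y\|$ for all $x,y\in\mathbb{R}^n$. Let $\{x_k\}_{k\ge 0}$ be the sequence generated by the full-step regularized method (described in the context) with parameters $r\in[3,\infty)$, $\tau\in[0,\infty)$, $\sigma_{\max}\in[0,\infty)$ and symmetric matrices $\{Q_k\}$. Suppose that there are $\eta\in(0,1)$, a real number $a\ge 2\tau+\frac{L}{1-\eta}$, and a sequence $\{\psi_k\}\subseteq[0,\infty)$ with $\sum_{k=0}^\infty\psi_k<\infty$ such that, for all $k\ge 0$, $Q_k\succeq aI$ and $Q_{k+1}\preceq(1+\psi_k)Q_k$. Then $$f(x_k)-f^*\le\frac{R^2(f(x_0)-f^* )}{R^2+\nu k(f(x_0)-f^* )}\quad\forall k\ge1,$$ where $f^*:=\min_{x\in\mathbb{R}^n}f(x)$ and $$\nu:=\frac{\eta c}{(\tau+b+\sigma_{\max}T^{r-2})^2}>0,$$ while the constants $R$, $b$, $c$ and $T$ are those defined in the context.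
   Context: $\|\cdot\|$ is the Euclidean norm and, for matrices, the induced operator norm; for a symmetric positive definite matrix $Q$, $\|v\|_Q=(v^TQv)^{1/2}$. For symmetric matrices, $A\preceq B$ (equivalently $B\succeq A$) means $B-A$ is positive semidefinite. Full-step regularized method. Given $r\in[3,\infty)$, $\tau\in[0,\infty)$, $\sigma_{\max}\in[0,\infty)$ and a starting point $x_0\in\mathbb{R}^n$, at each iteration $k=0,1,\ldots$ one chooses any $\sigma_k\in[0,\sigma_{\max}]$, computes a symmetric matrix $Q_k\in\mathbb{R}^{n\times n}$, defines the model $$m_k(s)=f(x_k)+\nabla f(x_k)^Ts+\tfrac12 s^TQ_ks+\tfrac{\sigma_k}{r}\|s\|^r,$$ computes $s_k\in\mathbb{R}^n$ with $\|\nabla m_k(s_k)\|\le\tau\|s_k\|\min\{\|s_k\|,1\}$, and sets $x_{k+1}=x_k+s_k$. Constants. $c:=\tfrac12a-\tau>0$; $b\in\mathbb{R}$ is a number with $\|Q_k\|\le b$ for all $k\ge0$ (which exists under the hypotheses); $T:=\max_{k\ge0}\|s_k\|<\infty$. Under the hypotheses, $\{x_k\}$ is a variable metric quasi-Fejér monotone sequence with respect to $\mathcal{F}:=\{x\in\mathbb{R}^n\colon f(x)\le\lim_{j\to\infty}f(x_j)\}$ relative to $\{Q_k\}$, meaning that for all $y\in\mathcal{F}$ $$\|x_{k+1}-y\|_{Q_{k+1}}^2\le(1+\tilde\psi_k)\|x_k-y\|_{Q_k}^2+\tilde\epsilon_k\quad\forall k\ge0,$$ where $\{\tilde\psi_k\},\{\tilde\epsilon_k\}\subseteq[0,\infty)$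 are summable sequences. With these sequences and a minimizer $x^*$ of $f$ (so $x^*\in\mathcal{F}$), $$R:=\Biggl(\frac1a\prod_{j=0}^\infty(1+\tilde\psi_j)\biggl(\|x_0-x^*\|_{Q_0}^2+\sum_{i=0}^\infty\tilde\epsilon_i\biggr)\Biggr)^{1/2}<\infty.$$ *)

theory Defs
  imports "HOL-Analysis.Analysis"
begin

definition gradient :: "('a::real_inner \<Rightarrow> real) \<Rightarrow> 'a \<Rightarrow> 'a" where
  "gradient F x = (THE D. GDERIV F x :> D)"

lemma gradient_eqI:
  assumes "GDERIV F x :> D"
  shows "gradient F x = D"
  unfolding gradient_def
proof (rule the_equality)
  fix D' assume "GDERIV F x :> D'"
  then have "(\<lambda>h. inner h D') = (\<lambda>h. inner h D)"
    using assms unfolding gderiv_def by (rule has_derivative_unique)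
  then have "inner (D' - D) (D' - D) = 0"
    by (metis inner_diff_right diff_self)
  then show "D' = D" by simp
qed (fact assms)

definition continuously_differentiable :: "('a::real_inner \<Rightarrow> real) \<Rightarrow> bool" where
  "continuously_differentiable F \<longleftrightarrow>
     (\<forall>x. \<exists>D. GDERIV F x :> D) \<and> continuous_on UNIV (gradient F)"

definition minimizer :: "('a \<Rightarrow> real) \<Rightarrow> 'a \<Rightarrow> bool" where
  "minimizer F z \<longleftrightarrow> (\<forall>y. F z \<le> F y)"

definition psd :: "real ^ 'n ^ 'n \<Rightarrow> bool" where
  "psd A \<longleftrightarrow> transpose A = A \<and> (\<forall>v. 0 \<le> v \<bullet> (A *v v))"

definition loewner_le :: "real ^ 'n ^ 'n \<Rightarrow> real ^ 'n ^ 'n \<Rightarrow> bool" where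
  "loewner_le A B \<longleftrightarrow> psd (B - A)"

definition opnorm :: "real ^ 'n ^ 'n \<Rightarrow> real" where
  "opnorm A = onorm (\<lambda>v. A *v v)"

definition wnorm :: "real ^ 'n ^ 'n \<Rightarrow> real ^ 'n \<Rightarrow> real" where
  "wnorm Q v = sqrt (v \<bullet> (Q *v v))"

definition model ::
  "(real ^ 'n \<Rightarrow> real) \<Rightarrow> real \<Rightarrow> real ^ 'n \<Rightarrow> real ^ 'n ^ 'n \<Rightarrow> real \<Rightarrow> real ^ 'n \<Rightarrow> real" where
  "model f r x Q \<sigma> s =
     f x + gradient f x \<bullet> s + 1 / 2 * (s \<bullet> (Q *v s)) + \<sigma> / r * norm s powr r"

text \<open>The sequences \<open>x\<close>, \<open>s\<close>, \<open>Q\<close>, \<open>\<sigma>\<close> form a possible run of the full-step regularized method;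
  the choices of \<open>\<sigma> k\<close>, \<open>Q k\<close> and the inexact stationary point \<open>s k\<close> are nondeterministic.\<close>

definition full_step_method ::
  "(real ^ 'n \<Rightarrow> real) \<Rightarrow> real \<Rightarrow> real \<Rightarrow> real \<Rightarrow>
   (nat \<Rightarrow> real ^ 'n) \<Rightarrow> (nat \<Rightarrow> real ^ 'n) \<Rightarrow> (nat \<Rightarrow> real ^ 'n ^ 'n) \<Rightarrow> (nat \<Rightarrow> real) \<Rightarrow> bool" where
  "full_step_method f r \<tau> \<sigma>max x s Q \<sigma> \<longleftrightarrow>
     (\<forall>k. 0 \<le> \<sigma> k \<and> \<sigma> k \<le> \<sigma>max \<and>
          transpose (Q k) = Q k \<and>
          norm (gradient (model f r (x k) (Q k) (\<sigma> k)) (s k))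
            \<le> \<tau> * norm (s k) * min (norm (s k)) 1 \<and>
          x (Suc k) = x k + s k)"

definition quasi_fejer ::
  "(real ^ 'n) set \<Rightarrow> (nat \<Rightarrow> real ^ 'n ^ 'n) \<Rightarrow> (nat \<Rightarrow> real ^ 'n) \<Rightarrow>
   (nat \<Rightarrow> real) \<Rightarrow> (nat \<Rightarrow> real) \<Rightarrow> bool" where
  "quasi_fejer S Q x \<psi> \<epsilon> \<longleftrightarrow>
     (\<forall>k. 0 \<le> \<psi> k) \<and> (\<forall>k. 0 \<le> \<epsilon> k) \<and> summable \<psi> \<and> summable \<epsilon> \<and>
     (\<forall>y\<in>S. \<forall>k. (wnorm (Q (Suc k)) (x (Suc k) - y))\<^sup>2
                    \<le> (1 + \<psi> k) * (wnorm (Q k) (x k - y))\<^sup>2 + \<epsilon> k)"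

definition limit_sublevel :: "(real ^ 'n \<Rightarrow> real) \<Rightarrow> (nat \<Rightarrow> real ^ 'n) \<Rightarrow> (real ^ 'n) set" where
  "limit_sublevel f x = {y. f y \<le> lim (\<lambda>j. f (x j))}"

definition radius ::
  "real \<Rightarrow> (nat \<Rightarrow> real ^ 'n ^ 'n) \<Rightarrow> (nat \<Rightarrow> real ^ 'n) \<Rightarrow> real ^ 'n \<Rightarrow>
   (nat \<Rightarrow> real) \<Rightarrow> (nat \<Rightarrow> real) \<Rightarrow> real" where
  "radius a Q x z \<psi> \<epsilon> =
     sqrt (1 / a * prodinf (\<lambda>j. 1 + \<psi> j) * ((wnorm (Q 0) (x 0 - z))\<^sup>2 + (\<Sum>i. \<epsilon> i)))"

end

theory Submission
  imports Defs
begin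

text \<open>
  The gradient of the model at the step expresses the gradient of the objective through the
  residual, \<open>Q k *v s k\<close> and the regularization term. With the descent lemma this gives the
  decrease \<open>f (x k) - f (x (k + 1)) \<ge> \<eta> c (norm (s k))\<^sup>2\<close>, so the squared steps are summable. Solving
  the same identity for \<open>Q k *v s k\<close> and using convexity bounds the growth of the weighted distance
  to any point of the limit sublevel set by a factor and a term that are perturbations of order
  \<open>(norm (s k))\<^sup>2\<close>; this is quasi-Fejer monotonicity. Hence all iterates stay within distance \<open>R\<close> of
  a minimizer, and the gap \<open>\<delta> k = f (x k) - fmin\<close> is at most \<open>R * norm (gradient f (x k))\<close>, while that gradient is at most a
  multiple of \<open>norm (s k)\<close>. Therefore \<open>\<delta> (k + 1) \<le> \<delta> k - \<nu> (\<delta> k)\<^sup>2 / R\<^sup>2\<close>, i.e. \<open>1 / \<delta>\<close> grows by at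
  least \<open>\<nu> / R\<^sup>2\<close> in every iteration.
\<close>

section \<open>Calculus along segments: descent lemma and tangent inequality\<close>

lemma DERIV_nonpos_imp_le_unit_interval:
  fixes h :: "real \<Rightarrow> real"
  assumes "\<And>t. 0 \<le> t \<Longrightarrow> t \<le> 1 \<Longrightarrow> (h has_real_derivative h' t) (at t) \<and> h' t \<le> 0"
  shows "h 1 \<le> h 0"
  by (rule DERIV_nonpos_imp_nonincreasing[of 0 1 h]) (use assms in auto)

lemma GDERIV_gradient:
  assumes "continuously_differentiable f"
  shows "GDERIV f x :> gradient f x"
  using assms gradient_eqI unfolding continuously_differentiable_def by metis

lemma GDERIV_has_real_derivative_line:
  fixes f :: "'a::real_inner \<Rightarrow> real"
  assumes "GDERIV f (x + t *\<^sub>R d) :> D"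
  shows "((\<lambda>t. f (x + t *\<^sub>R d)) has_real_derivative D \<bullet> d) (at t)"
proof -
  have "((\<lambda>t. f (x + t *\<^sub>R d)) has_derivative (\<lambda>h. (h *\<^sub>R d) \<bullet> D)) (at t)"
    by (rule has_derivative_compose[where f = "\<lambda>t. x + t *\<^sub>R d" and g = f])
      (use assms in \<open>auto simp: gderiv_def intro!: derivative_eq_intros\<close>)
  then show ?thesis
    by (rule has_derivative_imp_has_field_derivative) (simp add: inner_commute mult.commute)
qed

text \<open>The descent lemma. Along the segment, \<open>h\<close> is \<open>f\<close> minus the
  claimed bound up to a constant; its derivative is nonpositive by Cauchy-Schwarz and the Lipschitz
  condition.\<close>

lemma lipschitz_gradient_upper_bound:
  fixes f :: "'a::real_inner \<Rightarrow> real"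
  assumes diff: "continuously_differentiable f"
    and lip: "L-lipschitz_on UNIV (gradient f)"
  shows "f (x + d) \<le> f x + gradient f x \<bullet> d + L / 2 * (norm d)\<^sup>2"
proof -
  define h where
    "h t = f (x + t *\<^sub>R d) - t * (gradient f x \<bullet> d) - L / 2 * t\<^sup>2 * (norm d)\<^sup>2" for t :: real
  have "h 1 \<le> h 0"
  proof (rule DERIV_nonpos_imp_le_unit_interval[where h' =
        "\<lambda>t. gradient f (x + t *\<^sub>R d) \<bullet> d - gradient f x \<bullet> d - L * t * (norm d)\<^sup>2"], intro conjI)
    fix t :: real assume t: "0 \<le> t" "t \<le> 1"
    show "(h has_real_derivative
        gradient f (x + t *\<^sub>R d) \<bullet> d - gradient f x \<bullet> d - L * t * (norm d)\<^sup>2) (at t)"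
      unfolding h_def
      by (auto intro!: derivative_eq_intros
          GDERIV_has_real_derivative_line[OF GDERIV_gradient[OF diff]])
    have "(gradient f (x + t *\<^sub>R d) - gradient f x) \<bullet> d
        \<le> norm (gradient f (x + t *\<^sub>R d) - gradient f x) * norm d"
      by (rule norm_cauchy_schwarz)
    also have "\<dots> \<le> (L * norm (t *\<^sub>R d)) * norm d"
      using lipschitz_onD[OF lip, of "x + t *\<^sub>R d" x]
      by (intro mult_right_mono) (auto simp: dist_norm)
    finally show "gradient f (x + t *\<^sub>R d) \<bullet> d - gradient f x \<bullet> d - L * t * (norm d)\<^sup>2 \<le> 0"
      using t by (simp add: inner_diff_left power2_eq_square mult.assoc)
  qed
  then show ?thesis
    by (simp add: h_def)
qed

text \<open>Convexity passes to the restriction of \<open>f\<close> to the line through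
  \<open>x\<close> and \<open>y\<close>, and a convex function of one variable lies above its
  tangent at 0.\<close>

lemma convex_on_ge_gradient:
  fixes f :: "'a::real_inner \<Rightarrow> real"
  assumes diff: "continuously_differentiable f" and conv: "convex_on UNIV f"
  shows "f x + gradient f x \<bullet> (y - x) \<le> f y"
proof -
  let ?g = "\<lambda>t. f (x + t *\<^sub>R (y - x))"
  have "convex_on UNIV ?g"
  proof (rule convex_onI)
    fix t u v :: real assume t: "0 < t" "t < 1"
    have "x + ((1 - t) *\<^sub>R u + t *\<^sub>R v) *\<^sub>R (y - x)
        = (1 - t) *\<^sub>R (x + u *\<^sub>R (y - x)) + t *\<^sub>R (x + v *\<^sub>R (y - x))"
      by (simp add: algebra_simps)
    then show "?g ((1 - t) *\<^sub>R u + t *\<^sub>R v) \<le> (1 - t) * ?g u + t * ?g v"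
      using convex_onD[OF conv, of t] t by simp
  qed simp
  then have "?g 1 - ?g 0 \<ge> (gradient f x \<bullet> (y - x)) * (1 - 0)"
    by (rule convex_on_imp_above_tangent)
      (auto intro!: DERIV_subset GDERIV_has_real_derivative_line[where t = 0, simplified]
        GDERIV_gradient[OF diff])
  then show ?thesis
    by simp
qed

section \<open>Quadratic forms and the gradient of the model\<close>

lemma symmetric_matrix_inner:
  fixes A :: "real ^ 'n ^ 'n"
  assumes "transpose A = A"
  shows "u \<bullet> (A *v v) = (A *v u) \<bullet> v"
  by (metis assms dot_lmul_matrix vector_transpose_matrix)

lemma quadratic_form_add:
  fixes A :: "real ^ 'n ^ 'n"
  assumes "transpose A = A"
  shows "(u + v) \<bullet> (A *v (u + v)) = u \<bullet> (A *v u) + 2 * ((A *v u) \<bullet> v) + v \<bullet> (A *v v)"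
  using symmetric_matrix_inner[OF assms, of u v] inner_commute[of v "A *v u"]
  by (simp add: matrix_vector_right_distrib inner_add_left inner_add_right)

lemma GDERIV_quadratic_form:
  fixes A :: "real ^ 'n ^ 'n"
  assumes "transpose A = A"
  shows "GDERIV (\<lambda>v. v \<bullet> (A *v v)) x :> 2 *\<^sub>R (A *v x)"
  unfolding gderiv_def
  by (auto intro!: derivative_eq_intros
      bounded_linear.has_derivative[OF matrix_vector_mul_bounded_linear]
      simp: symmetric_matrix_inner[OF assms, of x] inner_commute)

text \<open>Away from the origin this is the chain rule. At the origin the norm is not
  differentiable, but the difference quotient of the power is \<open>norm v powr (r - 1)\<close>,
  which tends to 0 because \<open>r > 1\<close>.\<close>

lemma GDERIV_norm_powr:
  fixes x :: "'a::real_inner"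
  assumes "r > 1"
  shows "GDERIV (\<lambda>v. norm v powr r) x :> (r * norm x powr (r - 2)) *\<^sub>R x"
proof (cases "x = 0")
  case False
  have "((\<lambda>t. t powr r) has_real_derivative r * norm x powr (r - 1)) (at (norm x))"
    using False by (auto intro!: derivative_eq_intros)
  moreover have "GDERIV norm x :> sgn x"
    using False by (rule GDERIV_norm)
  ultimately have "GDERIV (\<lambda>v. norm v powr r) x :> (r * norm x powr (r - 1)) *\<^sub>R sgn x"
    using GDERIV_DERIV_compose by blast
  moreover
  have "norm x powr (r - 1) = norm x powr (r - 2) * norm x"
    using powr_mult_base[of "norm x" "r - 2"] by (simp add: mult.commute)
  then have "r * norm x powr (r - 1) * inverse (norm x) = r * norm x powr (r - 2)"
    using False by simp
  ultimately show ?thesis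
    by (simp add: sgn_div_norm)
next
  case True
  have "((\<lambda>v::'a. norm v powr (r - 1)) \<longlongrightarrow> 0) (at 0)"
    using assms by (intro tendsto_zero_powrI tendsto_norm_zero) auto
  then have "((\<lambda>v::'a. norm v powr r) has_derivative (\<lambda>_. 0)) (at 0)"
  proof (intro has_derivativeI_sandwich[of 1 _ _ _ _ "\<lambda>v. norm v powr (r - 1)"])
    fix v :: 'a assume "v \<noteq> 0"
    then show "norm (norm v powr r - norm (0::'a) powr r - 0) / norm (v - 0) \<le> norm v powr (r - 1)"
      using powr_mult_base[of "norm v" "r - 1"] by (simp add: field_simps)
  qed auto
  then show ?thesis
    using True by (simp add: gderiv_def)
qed

lemma gradient_model:
  fixes Q :: "real ^ 'n ^ 'n"
  assumes "transpose Q = Q" and "r \<ge> 3"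
  shows "gradient (model f r x Q \<sigma>) s
    = gradient f x + Q *v s + (\<sigma> * norm s powr (r - 2)) *\<^sub>R s"
proof (rule gradient_eqI)
  have quad: "((\<lambda>s. s \<bullet> (Q *v s)) has_derivative (\<lambda>h. h \<bullet> (2 *\<^sub>R (Q *v s)))) (at s)"
    using GDERIV_quadratic_form[OF assms(1)] by (simp add: gderiv_def)
  have pow: "((\<lambda>s. norm s powr r) has_derivative
      (\<lambda>h. h \<bullet> ((r * norm s powr (r - 2)) *\<^sub>R s))) (at s)"
    using GDERIV_norm_powr[of r s] assms(2) by (simp add: gderiv_def)
  have "(model f r x Q \<sigma> has_derivative
      (\<lambda>h. 0 + gradient f x \<bullet> h + 1 / 2 * (h \<bullet> (2 *\<^sub>R (Q *v s)))
        + \<sigma> / r * (h \<bullet> ((r * norm s powr (r - 2)) *\<^sub>R s)))) (at s)"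
    unfolding model_def
    by (intro has_derivative_add has_derivative_mult_right has_derivative_inner_right
        has_derivative_const has_derivative_ident quad pow)
  then show "GDERIV (model f r x Q \<sigma>) s :>
      gradient f x + Q *v s + (\<sigma> * norm s powr (r - 2)) *\<^sub>R s"
    unfolding gderiv_def
    by (rule has_derivative_eq_rhs) (use assms(2) in \<open>auto simp: inner_add_right inner_commute\<close>)
qed

section \<open>Positive semidefinite matrices\<close>

lemma psd_scaled_Cauchy_Schwarz:
  fixes A :: "real ^ 'n ^ 'n"
  assumes "psd A"
  shows "(u \<bullet> (A *v v))\<^sup>2 \<le> (u \<bullet> (A *v u)) * (v \<bullet> (A *v v))"
proof -
  have sym: "transpose A = A" and nn: "\<And>w. 0 \<le> w \<bullet> (A *v w)"
    using assms by (auto simp: psd_def)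
  let ?a = "u \<bullet> (A *v u)" and ?b = "u \<bullet> (A *v v)" and ?c = "v \<bullet> (A *v v)"
  \<comment> \<open>The form at \<open>t u + v\<close> is a quadratic in \<open>t\<close> that is
    never negative, so the claim is the sign of its discriminant.\<close>
  have quad: "0 \<le> ?a * t\<^sup>2 + 2 * ?b * t + ?c" for t
  proof -
    have "(t *\<^sub>R u + v) \<bullet> (A *v (t *\<^sub>R u + v)) = ?a * t\<^sup>2 + 2 * ?b * t + ?c"
      unfolding quadratic_form_add[OF sym]
      by (simp add: matrix_vector_mult_scaleR power2_eq_square
          symmetric_matrix_inner[OF sym, of u v])
    then show ?thesis
      by (metis nn)
  qed
  show ?thesis
  proof (cases "?a = 0")
    case True
    have "?b = 0"
    proof (rule ccontr)
      assume "?b \<noteq> 0"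
      \<comment> \<open>The quadratic is now linear in \<open>t\<close>, and this choice of
        \<open>t\<close> gives it the value -1.\<close>
      then show False
        using quad[of "- (?c + 1) / (2 * ?b)"] True by simp
    qed
    then show ?thesis
      using True by simp
  next
    case False
    then have pos: "?a > 0"
      using nn[of u] by linarith
    \<comment> \<open>This is the minimum of the quadratic, attained at
      \<open>t = - ?b / ?a\<close>, scaled by \<open>?a\<close>.\<close>
    have "0 \<le> ?a * (?a * (- ?b / ?a)\<^sup>2 + 2 * ?b * (- ?b / ?a) + ?c)"
      using pos quad[of "- ?b / ?a"] by (intro mult_nonneg_nonneg) auto
    also have "\<dots> = ?a * ?c - ?b\<^sup>2"
      using pos by (simp add: field_simps power2_eq_square)
    finally show ?thesis
      by simp
  qed
qed

text \<open>Cauchy-Schwarz for the form with \<open>u = A *v v\<close> bounds the fourth power of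
  \<open>norm (A *v v)\<close> by two values of the form; one factor
  \<open>(norm (A *v v))\<^sup>2\<close> then cancels.\<close>

lemma psd_norm_matrix_vector_le:
  fixes A :: "real ^ 'n ^ 'n"
  assumes psd: "psd A" and bound: "\<And>v. v \<bullet> (A *v v) \<le> B * (norm v)\<^sup>2"
  shows "norm (A *v v) \<le> B * norm v"
proof (cases "A *v v = 0")
  case True
  have "0 \<le> B * (norm v)\<^sup>2"
    using psd bound[of v] by (meson order_trans psd_def)
  then show ?thesis
    using True by (cases "v = 0") (auto simp: zero_le_mult_iff)
next
  case False
  let ?w = "A *v v"
  have nn: "0 \<le> w \<bullet> (A *v w)" for w
    using psd by (simp add: psd_def)
  have "0 \<le> B * (norm ?w)\<^sup>2"
    using order_trans[OF nn bound] .
  then have "0 \<le> B"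
    using False by (simp add: zero_le_mult_iff)
  have "((norm ?w)\<^sup>2)\<^sup>2 \<le> (B * (norm ?w)\<^sup>2) * (B * (norm v)\<^sup>2)"
    using psd_scaled_Cauchy_Schwarz[OF psd, of ?w v] mult_mono[OF bound bound _ nn, of ?w v]
    by (metis (no_types, lifting) \<open>0 \<le> B * (norm ?w)\<^sup>2\<close> order_trans power2_norm_eq_inner)
  then have "(norm ?w)\<^sup>2 * (norm ?w)\<^sup>2 \<le> (norm ?w)\<^sup>2 * (B * norm v)\<^sup>2"
    by (simp add: power2_eq_square mult_ac)
  then have "(norm ?w)\<^sup>2 \<le> (B * norm v)\<^sup>2"
    by (rule mult_left_le_imp_le) (use False in simp)
  then show ?thesis
    by (rule power2_le_imp_le) (use \<open>0 \<le> B\<close> in simp)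
qed

lemma norm_matrix_vector_le_opnorm:
  "norm (A *v v) \<le> opnorm A * norm v"
  unfolding opnorm_def by (rule onorm) (rule matrix_vector_mul_bounded_linear)

lemma wnorm_power2:
  assumes "psd A"
  shows "(wnorm A v)\<^sup>2 = v \<bullet> (A *v v)"
  using assms by (simp add: psd_def wnorm_def)

section \<open>Scalar recursions: summable perturbations and quadratic decrease\<close>

lemma convergent_prod_one_plus:
  fixes \<psi> :: "nat \<Rightarrow> real"
  assumes "\<And>k. 0 \<le> \<psi> k" and "summable \<psi>"
  shows "convergent_prod (\<lambda>k. 1 + \<psi> k)"
proof (rule summable_imp_convergent_prod_real)
  show "\<psi> k \<noteq> - 1" for k
    using assms(1)[of k] by linarith
qed (use assms in simp)

lemma prodinf_one_plus_ge_one: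
  fixes \<psi> :: "nat \<Rightarrow> real"
  assumes "\<And>k. 0 \<le> \<psi> k" and "summable \<psi>"
  shows "1 \<le> prodinf (\<lambda>k. 1 + \<psi> k)"
  using prod_le_prodinf[OF convergent_prod_has_prod[OF convergent_prod_one_plus[OF assms]], of 0] assms
  by (simp add: add_increasing2)

lemma perturbed_recursion_bound:
  fixes u \<psi> \<epsilon> :: "nat \<Rightarrow> real"
  assumes u0: "0 \<le> u 0"
    and \<psi>: "\<And>k. 0 \<le> \<psi> k" "summable \<psi>"
    and \<epsilon>: "\<And>k. 0 \<le> \<epsilon> k" "summable \<epsilon>"
    and step: "\<And>k. u (Suc k) \<le> (1 + \<psi> k) * u k + \<epsilon> k"
  shows "u k \<le> prodinf (\<lambda>j. 1 + \<psi> j) * (u 0 + suminf \<epsilon>)"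
proof -
  have ge1: "1 \<le> (\<Prod>j<k. 1 + \<psi> j)" for k
    using \<psi>(1) by (intro prod_ge_1) simp
  have "u k \<le> (\<Prod>j<k. 1 + \<psi> j) * (u 0 + sum \<epsilon> {..<k})"
  proof (induction k)
    case (Suc k)
    have "u (Suc k) \<le> (1 + \<psi> k) * ((\<Prod>j<k. 1 + \<psi> j) * (u 0 + sum \<epsilon> {..<k})) + \<epsilon> k"
      using Suc.IH \<psi>(1)[of k] step[of k] by (smt (verit) mult_left_mono)
    \<comment> \<open>Enlarging \<open>\<epsilon> k\<close> by the product, which is at least 1,
      allows the product to be factored out.\<close>
    also have "\<dots> \<le> (1 + \<psi> k) * ((\<Prod>j<k. 1 + \<psi> j) * (u 0 + sum \<epsilon> {..<k}))
        + (\<Prod>j<Suc k. 1 + \<psi> j) * \<epsilon> k"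
      using mult_right_mono[OF ge1[of "Suc k"] \<epsilon>(1)[of k]] by simp
    also have "\<dots> = (\<Prod>j<Suc k. 1 + \<psi> j) * (u 0 + sum \<epsilon> {..<Suc k})"
      by (simp add: algebra_simps)
    finally show ?case .
  qed simp
  also have "\<dots> \<le> prodinf (\<lambda>j. 1 + \<psi> j) * (u 0 + suminf \<epsilon>)"
  proof (rule mult_mono)
    show "(\<Prod>j<k. 1 + \<psi> j) \<le> prodinf (\<lambda>j. 1 + \<psi> j)"
      by (rule prod_le_prodinf[OF convergent_prod_has_prod[OF convergent_prod_one_plus[OF \<psi>]]])
        (simp_all add: \<psi>(1) add_increasing2)
    show "u 0 + sum \<epsilon> {..<k} \<le> u 0 + suminf \<epsilon>"
      using sum_le_suminf[OF \<epsilon>(2), of "{..<k}"] \<epsilon>(1) by simp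
    show "0 \<le> prodinf (\<lambda>j. 1 + \<psi> j)"
      using prodinf_one_plus_ge_one[OF \<psi>] by simp
    show "0 \<le> u 0 + sum \<epsilon> {..<k}"
      using u0 \<epsilon>(1) by (simp add: sum_nonneg)
  qed
  finally show ?thesis .
qed

text \<open>In terms of reciprocals, \<open>1 / \<delta>\<close> grows by at least
  \<open>\<nu> / B\<close> per step. The induction uses the form with denominators cleared, which
  also covers sequences that reach 0. For \<open>B = 0\<close> the right-hand side is 0, whence the
  last assumption.\<close>

lemma quadratic_decrease_rate:
  fixes \<delta> :: "nat \<Rightarrow> real"
  assumes nonneg: "\<And>k. 0 \<le> \<delta> k" and "0 \<le> B" and "0 < \<nu>"
    and step: "\<And>k. \<nu> * (\<delta> k)\<^sup>2 \<le> B * (\<delta> k - \<delta> (Suc k))"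
    and "B = 0 \<Longrightarrow> \<delta> k = 0"
  shows "\<delta> k \<le> B * \<delta> 0 / (B + \<nu> * real k * \<delta> 0)"
proof (cases "B = 0")
  case True
  then show ?thesis
    using assms(5) by simp
next
  case False
  then have "0 < B"
    using \<open>0 \<le> B\<close> by simp
  have "\<delta> k * (B + \<nu> * real k * \<delta> 0) \<le> B * \<delta> 0"
  proof (induction k)
    case (Suc k)
    let ?D = "B + \<nu> * real k * \<delta> 0"
    have D: "0 < ?D"
      using \<open>0 < B\<close> \<open>0 < \<nu>\<close> nonneg[of 0] by (simp add: add_pos_nonneg)
    have mono: "\<delta> (Suc k) \<le> \<delta> k"
    proof -
      have "0 \<le> B * (\<delta> k - \<delta> (Suc k))"
        using step[of k] \<open>0 < \<nu>\<close> by (smt (verit) mult_nonneg_nonneg zero_le_power2)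
      then show ?thesis
        using \<open>0 < B\<close> by (simp add: zero_le_mult_iff)
    qed
    show ?case
    proof (cases "\<delta> k = 0")
      case True
      then have "\<delta> (Suc k) = 0"
        using mono nonneg[of "Suc k"] by simp
      then show ?thesis
        using nonneg[of 0] \<open>0 < B\<close> by simp
    next
      case False
      then have pos: "0 < \<delta> k"
        using nonneg[of k] by simp
      \<comment> \<open>Replacing one factor \<open>\<delta> k\<close> by the smaller
        \<open>\<delta> (Suc k)\<close> gives the cleared form of
        \<open>1 / \<delta> (Suc k) - 1 / \<delta> k \<ge> \<nu> / B\<close>.\<close>
      have "\<nu> * \<delta> (Suc k) * \<delta> k \<le> \<nu> * (\<delta> k)\<^sup>2"
        using mono pos \<open>0 < \<nu>\<close> by (simp add: power2_eq_square)
      then have "\<nu> * \<delta> (Suc k) * \<delta> k \<le> B * (\<delta> k - \<delta> (Suc k))"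
        using step[of k] by linarith
      then have "\<delta> 0 * (\<nu> * \<delta> (Suc k) * \<delta> k) \<le> \<delta> 0 * (B * (\<delta> k - \<delta> (Suc k)))"
        using nonneg[of 0] by (rule mult_left_mono)
      moreover have "\<delta> (Suc k) * (\<delta> k * ?D) \<le> \<delta> (Suc k) * (B * \<delta> 0)"
        using Suc.IH nonneg[of "Suc k"] by (rule mult_left_mono)
      \<comment> \<open>In the sum of the two inequalities the terms
        \<open>B * \<delta> 0 * \<delta> (Suc k)\<close> cancel.\<close>
      ultimately have "\<delta> k * (\<delta> (Suc k) * (?D + \<nu> * \<delta> 0)) \<le> \<delta> k * (B * \<delta> 0)"
        by (simp add: algebra_simps)
      then have "\<delta> (Suc k) * (?D + \<nu> * \<delta> 0) \<le> B * \<delta> 0"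
        using pos by (rule mult_left_le_imp_le)
      then show ?thesis
        by (simp add: algebra_simps)
    qed
  qed simp
  moreover have "0 < B + \<nu> * real k * \<delta> 0"
    using \<open>0 < B\<close> \<open>0 < \<nu>\<close> nonneg[of 0] by (simp add: add_pos_nonneg)
  ultimately show ?thesis
    by (simp add: pos_le_divide_eq)
qed

text \<open>Trades a distance for a squared distance, as a recursion for squared distances
  demands.\<close>

lemma two_mult_le_one_plus_square:
  fixes t :: real
  shows "2 * t \<le> 1 + t\<^sup>2"
  using zero_le_power2[of "t - 1"] by (simp add: power2_diff)

section \<open>A run of the method: residuals and bounds on the matrices\<close>

locale full_step_run =
  fixes f :: "real ^ 'n \<Rightarrow> real"
    and x s :: "nat \<Rightarrow> real ^ 'n"
    and Q :: "nat \<Rightarrow> real ^ 'n ^ 'n"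
    and \<sigma> \<psi> :: "nat \<Rightarrow> real"
    and r \<tau> \<sigma>max L \<eta> a :: real
  assumes diff: "continuously_differentiable f"
    and conv: "convex_on UNIV f"
    and ex_minimizer: "\<exists>z. minimizer f z"
    and L_pos: "L > 0" and lip: "L-lipschitz_on UNIV (gradient f)"
    and r_ge: "r \<ge> 3" and \<tau>_nonneg: "\<tau> \<ge> 0" and \<sigma>max_nonneg: "\<sigma>max \<ge> 0"
    and run: "full_step_method f r \<tau> \<sigma>max x s Q \<sigma>"
    and \<eta>_pos: "0 < \<eta>" and \<eta>_less: "\<eta> < 1"
    and a_ge: "a \<ge> 2 * \<tau> + L / (1 - \<eta>)"
    and \<psi>_nonneg: "\<And>k. 0 \<le> \<psi> k" and \<psi>_summable: "summable \<psi>"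
    and Q_lower: "\<And>k. loewner_le (a *\<^sub>R mat 1) (Q k)"
    and Q_step: "\<And>k. loewner_le (Q (Suc k)) ((1 + \<psi> k) *\<^sub>R Q k)"
begin

definition residual :: "nat \<Rightarrow> real ^ 'n" where
  "residual k = gradient (model f r (x k) (Q k) (\<sigma> k)) (s k)"

lemma \<sigma>_nonneg: "0 \<le> \<sigma> k" and \<sigma>_le: "\<sigma> k \<le> \<sigma>max"
  and Q_symmetric: "transpose (Q k) = Q k"
  and x_Suc: "x (Suc k) = x k + s k"
  and residual_le_min: "norm (residual k) \<le> \<tau> * norm (s k) * min (norm (s k)) 1"
  using run by (auto simp: full_step_method_def residual_def)

lemma residual_le: "norm (residual k) \<le> \<tau> * norm (s k)"
  using residual_le_min[of k] mult_left_mono[of "min (norm (s k)) 1" 1 "\<tau> * norm (s k)"] \<tau>_nonneg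
  by simp

text \<open>The linear bound serves the decrease and gradient estimates; this quadratic one makes
  the residual an error that is summable along with the squared steps.\<close>

lemma residual_le_sq: "norm (residual k) \<le> \<tau> * (norm (s k))\<^sup>2"
  using residual_le_min[of k] \<tau>_nonneg
    mult_left_mono[of "min (norm (s k)) 1" "norm (s k)" "\<tau> * norm (s k)"]
  by (simp add: power2_eq_square mult.assoc)

lemma residual_eq:
  "residual k = gradient f (x k) + Q k *v s k + (\<sigma> k * norm (s k) powr (r - 2)) *\<^sub>R s k"
  unfolding residual_def by (rule gradient_model[OF Q_symmetric r_ge])

lemma L_le: "L \<le> (1 - \<eta>) * (a - 2 * \<tau>)"
  using a_ge \<eta>_less by (simp add: field_simps)

lemma a_gt: "2 * \<tau> < a"
  using a_ge L_pos \<eta>_less by (smt (verit) divide_pos_pos)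

lemma a_pos: "0 < a"
  using a_gt \<tau>_nonneg by linarith

lemma form_lower: "a * (norm v)\<^sup>2 \<le> v \<bullet> (Q k *v v)"
proof -
  have "0 \<le> v \<bullet> ((Q k - a *\<^sub>R mat 1) *v v)"
    using Q_lower[of k] by (simp add: loewner_le_def psd_def)
  then show ?thesis
    by (simp add: matrix_vector_mult_diff_rdistrib inner_diff_right power2_norm_eq_inner
        flip: scaleR_matrix_vector_assoc)
qed

lemma psd_Q: "psd (Q k)"
  unfolding psd_def
  using Q_symmetric form_lower a_pos by (meson mult_nonneg_nonneg order_less_imp_le order_trans zero_le_power2)

lemma form_nonneg: "0 \<le> v \<bullet> (Q k *v v)"
  using psd_Q by (simp add: psd_def)

lemma form_step: "v \<bullet> (Q (Suc k) *v v) \<le> (1 + \<psi> k) * (v \<bullet> (Q k *v v))"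
proof -
  have "0 \<le> v \<bullet> (((1 + \<psi> k) *\<^sub>R Q k - Q (Suc k)) *v v)"
    using Q_step[of k] by (simp add: loewner_le_def psd_def)
  then show ?thesis
    by (simp add: matrix_vector_mult_diff_rdistrib inner_diff_right
        flip: scaleR_matrix_vector_assoc)
qed

text \<open>Each quadratic form grows at most by the factors \<open>1 + \<psi> k\<close>, whose
  infinite product converges. This bounds the forms uniformly, and positive semidefiniteness turns
  the bound into one on operator norms.\<close>

lemma opnorm_Q_bounded: "\<exists>b. \<forall>k. opnorm (Q k) \<le> b"
proof (intro exI allI)
  fix k
  let ?P = "prodinf (\<lambda>j. 1 + \<psi> j)"
  have "norm (Q k *v v) \<le> (?P * opnorm (Q 0)) * norm v" for v
  proof (rule psd_norm_matrix_vector_le[OF psd_Q])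
    fix v
    have "v \<bullet> (Q k *v v) \<le> ?P * (v \<bullet> (Q 0 *v v) + suminf (\<lambda>_. 0))"
      by (rule perturbed_recursion_bound[where u = "\<lambda>k. v \<bullet> (Q k *v v)"])
        (auto simp: form_nonneg \<psi>_nonneg \<psi>_summable form_step)
    moreover have "v \<bullet> (Q 0 *v v) \<le> opnorm (Q 0) * (norm v)\<^sup>2"
      using norm_cauchy_schwarz[of v "Q 0 *v v"]
        mult_left_mono[OF norm_matrix_vector_le_opnorm[of "Q 0" v], of "norm v"]
      by (simp add: power2_eq_square mult_ac)
    moreover have "0 \<le> ?P"
      using prodinf_one_plus_ge_one[OF \<psi>_nonneg \<psi>_summable] by simp
    ultimately show "v \<bullet> (Q k *v v) \<le> ?P * opnorm (Q 0) * (norm v)\<^sup>2"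
      using mult_left_mono[of "v \<bullet> (Q 0 *v v)" "opnorm (Q 0) * (norm v)\<^sup>2" ?P]
      by (simp add: mult.assoc)
  qed
  then show "opnorm (Q k) \<le> ?P * opnorm (Q 0)"
    unfolding opnorm_def by (rule onorm_le)
qed

text \<open>Makes every bound \<open>b\<close> on the operator norms positive, so that the
  denominator of the rate constant is nonzero.\<close>

lemma a_le_opnorm: "a \<le> opnorm (Q k)"
proof -
  obtain v :: "real ^ 'n" where v: "norm v = 1"
    using vector_choose_size[of 1] by auto
  have "a \<le> v \<bullet> (Q k *v v)"
    using form_lower[of v k] v by simp
  also have "\<dots> \<le> norm v * norm (Q k *v v)"
    by (rule norm_cauchy_schwarz)
  also have "\<dots> \<le> opnorm (Q k)"
    using norm_matrix_vector_le_opnorm[of "Q k" v] v by simp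
  finally show ?thesis .
qed

section \<open>Sufficient decrease and its consequences for values and steps\<close>

lemma sufficient_decrease: "\<eta> * (a / 2 - \<tau>) * (norm (s k))\<^sup>2 \<le> f (x k) - f (x (Suc k))"
proof -
  let ?g = "gradient f (x k)" and ?N = "(norm (s k))\<^sup>2"
  have "?g \<bullet> s k = residual k \<bullet> s k - (Q k *v s k) \<bullet> s k - \<sigma> k * norm (s k) powr (r - 2) * ?N"
    unfolding residual_eq by (simp add: inner_add_left power2_norm_eq_inner)
  moreover have "residual k \<bullet> s k \<le> \<tau> * ?N"
    using norm_cauchy_schwarz[of "residual k" "s k"]
      mult_right_mono[OF residual_le[of k], of "norm (s k)"]
    by (simp add: power2_eq_square mult.assoc)
  moreover have "a * ?N \<le> (Q k *v s k) \<bullet> s k"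
    using form_lower[of "s k" k] by (simp add: inner_commute)
  moreover have "0 \<le> \<sigma> k * norm (s k) powr (r - 2) * ?N"
    using \<sigma>_nonneg by simp
  moreover have "f (x (Suc k)) \<le> f (x k) + ?g \<bullet> s k + L / 2 * ?N"
    unfolding x_Suc by (rule lipschitz_gradient_upper_bound[OF diff lip])
  ultimately have "(a - \<tau> - L / 2) * ?N \<le> f (x k) - f (x (Suc k))"
    by (simp add: algebra_simps)
  \<comment> \<open>By \<open>L_le\<close>, the right-hand side is at least
    \<open>a / 2 + \<eta> * (a / 2 - \<tau>)\<close>.\<close>
  moreover have "\<eta> * (a / 2 - \<tau>) \<le> a - \<tau> - L / 2"
    using L_le a_gt \<tau>_nonneg by (simp add: algebra_simps)
  then have "\<eta> * (a / 2 - \<tau>) * ?N \<le> (a - \<tau> - L / 2) * ?N"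
    by (rule mult_right_mono) simp
  ultimately show ?thesis
    by linarith
qed

lemma \<eta>c_pos: "0 < \<eta> * (a / 2 - \<tau>)"
  using \<eta>_pos a_gt by simp

lemma decseq_f: "decseq (\<lambda>k. f (x k))"
proof (rule decseq_SucI)
  show "f (x (Suc k)) \<le> f (x k)" for k
    using sufficient_decrease[of k] \<eta>c_pos by (smt (verit) mult_nonneg_nonneg zero_le_power2)
qed

lemma convergent_f: "convergent (\<lambda>k. f (x k))"
proof -
  obtain z where "\<And>y. f z \<le> f y"
    using ex_minimizer by (auto simp: minimizer_def)
  then show ?thesis
    using decseq_convergent[OF decseq_f] by (metis convergentI)
qed

text \<open>Shows that points of the limit sublevel set have values no larger than any iterate,
  which is how membership enters the distance estimates.\<close>

lemma lim_f_le: "lim (\<lambda>j. f (x j)) \<le> f (x k)"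
  using decseq_ge[OF decseq_f] convergent_f by (simp add: convergent_LIMSEQ_iff)

lemma minimizer_in_limit_sublevel:
  assumes "minimizer f z"
  shows "z \<in> limit_sublevel f x"
  using LIMSEQ_le_const[of "\<lambda>j. f (x j)" "lim (\<lambda>j. f (x j))" "f z"] convergent_f assms
  by (auto simp: limit_sublevel_def minimizer_def convergent_LIMSEQ_iff)

text \<open>The decreases telescope to a convergent series, and each dominates a fixed multiple of
  the squared step.\<close>

lemma summable_norm_step_sq: "summable (\<lambda>k. (norm (s k))\<^sup>2)"
proof -
  have "summable (\<lambda>k. f (x k) - f (x (Suc k)))"
    using convergent_f telescope_summable' by (auto simp: convergent_def)
  then have "summable (\<lambda>k. \<eta> * (a / 2 - \<tau>) * (norm (s k))\<^sup>2)"
  proof (rule summable_comparison_test')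
    show "norm (\<eta> * (a / 2 - \<tau>) * (norm (s k))\<^sup>2) \<le> f (x k) - f (x (Suc k))" if "k \<ge> 0" for k
      using sufficient_decrease[of k] a_gt \<eta>_pos by (simp add: abs_mult)
  qed
  then show ?thesis
    using a_gt \<eta>_pos by (simp add: summable_cmult_iff)
qed

text \<open>The steps tend to 0, so from some \<open>N\<close> on they are shorter than a fixed
  nonzero step \<open>s i\<close>. Since \<open>i < N\<close>, the maximum over the indices below
  \<open>N\<close> dominates the tail too.\<close>

lemma norm_step_attains_max: "\<exists>k. \<forall>j. norm (s j) \<le> norm (s k)"
proof (cases "\<forall>j. s j = 0")
  case False
  then obtain i where "s i \<noteq> 0"
    by blast
  have "(\<lambda>k. (norm (s k))\<^sup>2) \<longlonglongrightarrow> 0"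
    by (rule summable_LIMSEQ_zero[OF summable_norm_step_sq])
  then have "\<forall>\<^sub>F k in sequentially. (norm (s k))\<^sup>2 < (norm (s i))\<^sup>2"
    by (rule order_tendstoD(2)) (use \<open>s i \<noteq> 0\<close> in simp)
  then obtain N where N: "\<And>k. k \<ge> N \<Longrightarrow> norm (s k) < norm (s i)"
    unfolding eventually_sequentially by (meson norm_ge_zero power_less_imp_less_base)
  have "i < N"
    using N[of i] by (meson less_irrefl not_le)
  then obtain k where "norm (s k) = (MAX j\<in>{..<N}. norm (s j))"
    using Max_in[of "(\<lambda>j. norm (s j)) ` {..<N}"] by (metis (no_types, lifting)
      empty_iff finite_imageI finite_lessThan image_iff image_is_empty lessThan_iff)
  then have k: "norm (s j) \<le> norm (s k)" if "j < N" for j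
    using that by simp
  have "norm (s j) \<le> norm (s k)" for j
    using k[of j] k[OF \<open>i < N\<close>] N[of j] by (cases "j < N") auto
  then show ?thesis
    by blast
qed simp

section \<open>Gradient bounds and quasi-Fejer monotonicity\<close>

lemma gradient_le:
  assumes "opnorm (Q k) \<le> b" and "norm (s k) \<le> T"
  shows "norm (gradient f (x k)) \<le> (\<tau> + b + \<sigma>max * T powr (r - 2)) * norm (s k)"
proof -
  let ?p = "\<sigma> k * norm (s k) powr (r - 2)"
  have p: "0 \<le> ?p" "?p \<le> \<sigma>max * T powr (r - 2)"
    using \<sigma>_nonneg[of k] \<sigma>_le[of k] \<sigma>max_nonneg assms(2) r_ge
    by (auto intro!: mult_mono powr_mono2)
  have "norm (gradient f (x k)) = norm (residual k - Q k *v s k - ?p *\<^sub>R s k)"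
    by (simp add: residual_eq)
  also have "\<dots> \<le> norm (residual k) + norm (Q k *v s k) + norm (?p *\<^sub>R s k)"
    by (rule order_trans[OF norm_triangle_ineq4 add_right_mono[OF norm_triangle_ineq4]])
  also have "\<dots> \<le> \<tau> * norm (s k) + b * norm (s k) + \<sigma>max * T powr (r - 2) * norm (s k)"
  proof (intro add_mono)
    show "norm (residual k) \<le> \<tau> * norm (s k)"
      by (rule residual_le)
    show "norm (Q k *v s k) \<le> b * norm (s k)"
      using norm_matrix_vector_le_opnorm assms(1) by (meson mult_right_mono norm_ge_zero order_trans)
    show "norm (?p *\<^sub>R s k) \<le> \<sigma>max * T powr (r - 2) * norm (s k)"
      using p by (simp add: mult_right_mono)
  qed
  finally show ?thesis
    by (simp add: algebra_simps)
qed

text \<open>Convexity bounds \<open>f y\<close> from below and the descent lemma bounds the next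
  value from above through the same tangent at \<open>x k\<close>; comparing the two eliminates
  \<open>f (x k)\<close>.\<close>

lemma gradient_gap_le:
  assumes "f y \<le> f (x (Suc k))"
  shows "- (gradient f (x k) \<bullet> (x (Suc k) - y)) \<le> L / 2 * (norm (s k))\<^sup>2"
proof -
  have "f (x k) + gradient f (x k) \<bullet> (y - x k) \<le> f y"
    by (rule convex_on_ge_gradient[OF diff conv])
  moreover have "f (x (Suc k)) \<le> f (x k) + gradient f (x k) \<bullet> s k + L / 2 * (norm (s k))\<^sup>2"
    unfolding x_Suc by (rule lipschitz_gradient_upper_bound[OF diff lip])
  ultimately show ?thesis
    using assms by (simp add: x_Suc inner_diff_right inner_add_right)
qed

text \<open>Splitting off one factor makes the regularization term quadratic in the step;
  \<open>r \<ge> 3\<close> keeps the remaining exponent nonnegative, hence the power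
  monotone.\<close>

lemma norm_powr_step_le:
  assumes "norm (s k) \<le> T"
  shows "norm (s k) powr (r - 2) * norm (s k) \<le> T powr (r - 3) * (norm (s k))\<^sup>2"
proof -
  have "norm (s k) powr (r - 2) = norm (s k) powr (r - 3) * norm (s k)"
    using powr_mult_base[of "norm (s k)" "r - 3"] by (simp add: mult.commute)
  moreover have "norm (s k) powr (r - 3) * (norm (s k))\<^sup>2 \<le> T powr (r - 3) * (norm (s k))\<^sup>2"
    using assms r_ge by (intro mult_right_mono powr_mono2) auto
  ultimately show ?thesis
    by (simp add: power2_eq_square mult.assoc)
qed

text \<open>The metric is still \<open>Q k\<close> on both sides. The cross term of the expansion
  contains \<open>Q k *v s k\<close>, which \<open>residual_eq\<close> expresses through quantities
  whose contributions are all of second order in the step.\<close>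

lemma form_distance_step:
  assumes y: "f y \<le> f (x (Suc k))" and T: "norm (s k) \<le> T"
  defines "K \<equiv> \<tau> + \<sigma>max * T powr (r - 3)"
  shows "(x (Suc k) - y) \<bullet> (Q k *v (x (Suc k) - y))
    \<le> (1 + K / a * (norm (s k))\<^sup>2) * ((x k - y) \<bullet> (Q k *v (x k - y)))
      + (K * (1 + 2 * T) + L) * (norm (s k))\<^sup>2"
proof -
  let ?u = "x k - y" and ?w = "x (Suc k) - y" and ?N = "(norm (s k))\<^sup>2"
  let ?p = "\<sigma> k * norm (s k) powr (r - 2)"
  have w: "?w = s k + ?u"
    by (simp add: x_Suc)
  have K: "0 \<le> K"
    using \<tau>_nonneg \<sigma>max_nonneg by (simp add: K_def)
  \<comment> \<open>Expanding the old distance around the new one puts \<open>?w\<close> into the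
    cross term, where \<open>gradient_gap_le\<close> applies, and leaves a square of favourable sign
    to drop.\<close>
  have u: "?u = ?w + - s k"
    by (simp add: x_Suc)
  have "?u \<bullet> (Q k *v ?u) = ?w \<bullet> (Q k *v ?w) - 2 * ((Q k *v s k) \<bullet> ?w) + s k \<bullet> (Q k *v s k)"
    using quadratic_form_add[OF Q_symmetric[of k], of ?w "- s k"]
      symmetric_matrix_inner[OF Q_symmetric[of k], of ?w "s k"] inner_commute[of ?w "Q k *v s k"]
    unfolding u by (simp add: vec.neg)
  then have expand: "?w \<bullet> (Q k *v ?w) \<le> ?u \<bullet> (Q k *v ?u) + 2 * ((Q k *v s k) \<bullet> ?w)"
    using form_nonneg[of "s k" k] by linarith
  have "(Q k *v s k) \<bullet> ?w = residual k \<bullet> ?w - gradient f (x k) \<bullet> ?w - ?p * (s k \<bullet> ?w)"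
    unfolding residual_eq by (simp add: inner_add_left)
  moreover have "residual k \<bullet> ?w \<le> \<tau> * ?N * norm ?w"
    using norm_cauchy_schwarz[of "residual k" ?w] mult_right_mono[OF residual_le_sq[of k], of "norm ?w"]
    by simp
  moreover have "- (?p * (s k \<bullet> ?w)) \<le> \<sigma>max * T powr (r - 3) * ?N * norm ?w"
  proof -
    have "- (?p * (s k \<bullet> ?w)) \<le> ?p * (norm (s k) * norm ?w)"
      using mult_left_mono[OF norm_cauchy_schwarz[of "- s k" ?w], of ?p] \<sigma>_nonneg by simp
    also have "\<dots> = \<sigma> k * (norm (s k) powr (r - 2) * norm (s k)) * norm ?w"
      by simp
    also have "\<dots> \<le> \<sigma>max * (T powr (r - 3) * ?N) * norm ?w"
      using norm_powr_step_le[OF T] \<sigma>_nonneg \<sigma>_le \<sigma>max_nonneg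
      by (intro mult_right_mono[OF mult_mono]) auto
    finally show ?thesis
      by (simp add: mult.assoc)
  qed
  moreover have "- (gradient f (x k) \<bullet> ?w) \<le> L / 2 * ?N"
    by (rule gradient_gap_le[OF y])
  moreover have "K * ?N * (2 * norm ?w)
      = 2 * (\<tau> * ?N * norm ?w) + 2 * (\<sigma>max * T powr (r - 3) * ?N * norm ?w)"
    by (simp add: K_def distrib_right)
  ultimately have cross: "2 * ((Q k *v s k) \<bullet> ?w) \<le> K * ?N * (2 * norm ?w) + L * ?N"
    by linarith
  \<comment> \<open>Bounding \<open>norm ?w\<close> by the old form plus constants splits the
    perturbation into a factor and an additive term.\<close>
  have "2 * norm ?w \<le> 2 * norm ?u + 2 * T"
    using norm_triangle_ineq[of "s k" ?u] T unfolding w by linarith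
  also have "\<dots> \<le> 1 + (norm ?u)\<^sup>2 + 2 * T"
    using two_mult_le_one_plus_square[of "norm ?u"] by simp
  also have "\<dots> \<le> 1 + (?u \<bullet> (Q k *v ?u)) / a + 2 * T"
    using form_lower[of ?u k] a_pos by (simp add: field_simps)
  finally have "K * ?N * (2 * norm ?w) \<le> K * ?N * (1 + (?u \<bullet> (Q k *v ?u)) / a + 2 * T)"
    using K by (intro mult_left_mono) auto
  with expand cross
  have "?w \<bullet> (Q k *v ?w) \<le> ?u \<bullet> (Q k *v ?u) + (K * ?N * (1 + (?u \<bullet> (Q k *v ?u)) / a + 2 * T) + L * ?N)"
    by linarith
  also have "U + (K * N * (1 + U / a + 2 * T) + L * N)
      = (1 + K / a * N) * U + (K * (1 + 2 * T) + L) * N" for N U :: real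
    by (simp add: algebra_simps)
  finally show ?thesis .
qed

lemma ex_quasi_fejer: "\<exists>\<psi>' \<epsilon>'. quasi_fejer (limit_sublevel f x) Q x \<psi>' \<epsilon>'"
proof -
  obtain i where T: "\<And>j. norm (s j) \<le> norm (s i)"
    using norm_step_attains_max by blast
  define T where "T = norm (s i)"
  define K where "K = \<tau> + \<sigma>max * T powr (r - 3)"
  define M where "M = K * (1 + 2 * T) + L"
  have K: "0 \<le> K"
    using \<tau>_nonneg \<sigma>max_nonneg by (simp add: K_def)
  have M: "0 \<le> M"
    using K L_pos by (simp add: M_def T_def)
  let ?N = "\<lambda>k. (norm (s k))\<^sup>2"
  \<comment> \<open>The mixed term is summable because the squared steps are bounded by
    \<open>T\<^sup>2\<close>.\<close>
  have summ: "summable (\<lambda>k. (1 + \<psi> k) * ?N k)"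
  proof -
    have "summable (\<lambda>k. \<psi> k * T\<^sup>2)"
      using \<psi>_summable by (rule summable_mult2)
    then have "summable (\<lambda>k. \<psi> k * ?N k)"
      by (rule summable_comparison_test'[where N = 0])
        (auto simp: \<psi>_nonneg abs_mult T_def intro!: mult_left_mono power_mono T)
    then show ?thesis
      using summable_add[OF summable_norm_step_sq] by (simp add: distrib_right)
  qed
  \<comment> \<open>Both sequences come from multiplying out the change of metric,
    \<open>1 + \<psi> k\<close>, with the bound of \<open>form_distance_step\<close>.\<close>
  define \<psi>' where "\<psi>' k = \<psi> k + K / a * ((1 + \<psi> k) * ?N k)" for k
  define \<epsilon>' where "\<epsilon>' k = M * ((1 + \<psi> k) * ?N k)" for k
  have "quasi_fejer (limit_sublevel f x) Q x \<psi>' \<epsilon>'"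
    unfolding quasi_fejer_def
  proof (intro conjI allI ballI)
    show "0 \<le> \<psi>' k" "0 \<le> \<epsilon>' k" for k
      using K M \<psi>_nonneg[of k] a_pos by (auto simp: \<psi>'_def \<epsilon>'_def)
    show "summable \<psi>'" "summable \<epsilon>'"
      unfolding \<psi>'_def \<epsilon>'_def by (intro summable_add summable_mult \<psi>_summable summ)+
    fix y k assume "y \<in> limit_sublevel f x"
    then have y: "f y \<le> f (x (Suc k))"
      using lim_f_le[of "Suc k"] by (simp add: limit_sublevel_def)
    let ?u = "x k - y" and ?w = "x (Suc k) - y"
    have "?w \<bullet> (Q (Suc k) *v ?w) \<le> (1 + \<psi> k) * (?w \<bullet> (Q k *v ?w))"
      by (rule form_step)
    also have "\<dots> \<le> (1 + \<psi> k) * ((1 + K / a * ?N k) * (?u \<bullet> (Q k *v ?u)) + M * ?N k)"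
      using form_distance_step[OF y T] \<psi>_nonneg[of k]
      by (intro mult_left_mono) (auto simp: K_def M_def T_def)
    also have "(1 + \<psi> k) * ((1 + K / a * ?N k) * U + M * ?N k) = (1 + \<psi>' k) * U + \<epsilon>' k"
      for U :: real
      by (simp add: \<psi>'_def \<epsilon>'_def algebra_simps add_divide_distrib)
    finally show "(wnorm (Q (Suc k)) ?w)\<^sup>2 \<le> (1 + \<psi>' k) * (wnorm (Q k) ?u)\<^sup>2 + \<epsilon>' k"
      by (simp add: wnorm_power2[OF psd_Q])
  qed
  then show ?thesis
    by blast
qed

section \<open>Distance to a minimizer and the sublinear rate\<close>

lemma distance_le_radius:
  assumes fejer: "quasi_fejer S Q x \<psi>' \<epsilon>'" and z: "z \<in> S"
  shows "norm (x k - z) \<le> radius a Q x z \<psi>' \<epsilon>'"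
proof -
  let ?R2 = "prodinf (\<lambda>j. 1 + \<psi>' j) * ((wnorm (Q 0) (x 0 - z))\<^sup>2 + suminf \<epsilon>')"
  \<comment> \<open>Returning from the weighted to the Euclidean norm costs the factor
    \<open>1 / a\<close> in the radius.\<close>
  have "a * (norm (x k - z))\<^sup>2 \<le> (wnorm (Q k) (x k - z))\<^sup>2"
    by (simp add: wnorm_power2[OF psd_Q] form_lower)
  also have "\<dots> \<le> ?R2"
    using fejer z
    by (intro perturbed_recursion_bound[where u = "\<lambda>k. (wnorm (Q k) (x k - z))\<^sup>2"])
      (auto simp: quasi_fejer_def)
  finally show ?thesis
    using a_pos unfolding radius_def by (intro real_le_rsqrt) (simp add: field_simps)
qed

lemma sublinear_rate:
  assumes b: "\<And>k. opnorm (Q k) \<le> b" and T: "\<And>k. norm (s k) \<le> T"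
    and z: "minimizer f z" and R: "\<And>k. norm (x k - z) \<le> R"
  defines "\<nu> \<equiv> \<eta> * (a / 2 - \<tau>) / (\<tau> + b + \<sigma>max * T powr (r - 2))\<^sup>2"
  shows "0 < \<nu>"
    and "f (x k) - f z \<le> R\<^sup>2 * (f (x 0) - f z) / (R\<^sup>2 + \<nu> * real k * (f (x 0) - f z))"
proof -
  define M where "M = \<tau> + b + \<sigma>max * T powr (r - 2)"
  have "0 < b"
    using a_pos a_le_opnorm[of 0] b[of 0] by linarith
  then have M: "0 < M"
    using \<tau>_nonneg \<sigma>max_nonneg by (simp add: M_def add_pos_nonneg add_nonneg_pos)
  show \<nu>: "0 < \<nu>"
    using M \<eta>c_pos by (simp add: \<nu>_def flip: M_def)
  have "0 \<le> R"
    using R[of 0] norm_ge_zero order_trans by blast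
  have gap: "0 \<le> f (x k) - f z" for k
    using z by (simp add: minimizer_def)
  have "\<nu> * (f (x k) - f z)\<^sup>2 \<le> R\<^sup>2 * ((f (x k) - f z) - (f (x (Suc k)) - f z))" for k
  proof -
    let ?g = "gradient f (x k)"
    have "f (x k) - f z \<le> ?g \<bullet> (x k - z)"
      using convex_on_ge_gradient[OF diff conv, of "x k" z] by (simp add: inner_diff_right)
    also have "\<dots> \<le> norm ?g * norm (x k - z)"
      by (rule norm_cauchy_schwarz)
    also have "\<dots> \<le> (M * norm (s k)) * R"
      using gradient_le[OF b T, of k] R[of k] M by (intro mult_mono) (auto simp: M_def)
    finally have "(f (x k) - f z)\<^sup>2 \<le> (M * norm (s k) * R)\<^sup>2"
      using gap by (rule power_mono)
    then have "\<nu> * (f (x k) - f z)\<^sup>2 \<le> \<nu> * (M * norm (s k) * R)\<^sup>2"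
      using \<nu> by (intro mult_left_mono) auto
    \<comment> \<open>The factor \<open>M\<^sup>2\<close> cancels the denominator of
      \<open>\<nu>\<close>.\<close>
    also have "\<dots> = R\<^sup>2 * (\<eta> * (a / 2 - \<tau>) * (norm (s k))\<^sup>2)"
      using M unfolding \<nu>_def M_def[symmetric] by (simp add: power_mult_distrib)
    also have "\<dots> \<le> R\<^sup>2 * (f (x k) - f (x (Suc k)))"
      by (rule mult_left_mono[OF sufficient_decrease]) simp
    finally show ?thesis
      by simp
  qed
  \<comment> \<open>For \<open>R = 0\<close> every iterate equals \<open>z\<close>; this is the
    degenerate case of \<open>quadratic_decrease_rate\<close>.\<close>
  moreover have "f (x k) - f z = 0" if "R\<^sup>2 = 0"
    using R[of k] that by simp
  ultimately show "f (x k) - f z \<le> R\<^sup>2 * (f (x 0) - f z) / (R\<^sup>2 + \<nu> * real k * (f (x 0) - f z))"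
    using gap \<nu> by (intro quadratic_decrease_rate[where \<delta> = "\<lambda>k. f (x k) - f z"]) auto
qed

end

text \<open>The existence claims show that the constants in the rate are available; the rate then
  holds for every admissible choice of them. Convergence of the values and of the product gives
  \<open>lim\<close> and \<open>prodinf\<close> their intended meaning, and attainment makes the
  supremum \<open>T\<close> a maximum.\<close>

theorem proposition3:
  fixes f :: "real ^ 'n \<Rightarrow> real"
    and x s :: "nat \<Rightarrow> real ^ 'n"
    and Q :: "nat \<Rightarrow> real ^ 'n ^ 'n"
    and \<sigma> \<psi> :: "nat \<Rightarrow> real"
    and r \<tau> \<sigma>max L \<eta> a c T fmin :: real
  assumes "continuously_differentiable f"
    and "convex_on UNIV f"
    and "\<exists>z. minimizer f z"
    and "L > 0" and "L-lipschitz_on UNIV (gradient f)"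
    and "r \<ge> 3" and "\<tau> \<ge> 0" and "\<sigma>max \<ge> 0"
    and "full_step_method f r \<tau> \<sigma>max x s Q \<sigma>"
    and "0 < \<eta>" and "\<eta> < 1"
    and "a \<ge> 2 * \<tau> + L / (1 - \<eta>)"
    and "\<And>k. 0 \<le> \<psi> k" and "summable \<psi>"
    and "\<And>k. loewner_le (a *\<^sub>R mat 1) (Q k)"
    and "\<And>k. loewner_le (Q (Suc k)) ((1 + \<psi> k) *\<^sub>R Q k)"
    and "c = 1 / 2 * a - \<tau>"
    and "T = (SUP k. norm (s k))"
    and "fmin = (INF y. f y)"
  shows "c > 0
    \<and> (\<exists>b. \<forall>k. opnorm (Q k) \<le> b)
    \<and> (\<exists>k. T = norm (s k) \<and> (\<forall>j. norm (s j) \<le> T))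
    \<and> convergent (\<lambda>j. f (x j))
    \<and> (\<exists>\<psi>' \<epsilon>'. quasi_fejer (limit_sublevel f x) Q x \<psi>' \<epsilon>')
    \<and> (\<forall>b \<psi>' \<epsilon>' z.
         (\<forall>k. opnorm (Q k) \<le> b) \<longrightarrow>
         quasi_fejer (limit_sublevel f x) Q x \<psi>' \<epsilon>' \<longrightarrow>
         minimizer f z \<longrightarrow>
         (let R = radius a Q x z \<psi>' \<epsilon>';
              \<nu> = \<eta> * c / (\<tau> + b + \<sigma>max * T powr (r - 2))\<^sup>2
          in z \<in> limit_sublevel f x
             \<and> convergent_prod (\<lambda>j. 1 + \<psi>' j)
             \<and> \<nu> > 0
             \<and> (\<forall>k\<ge>1. f (x k) - fmin
                   \<le> R\<^sup>2 * (f (x 0) - fmin) / (R\<^sup>2 + \<nu> * real k * (f (x 0) - fmin)))))"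
proof -
  interpret full_step_run f x s Q \<sigma> \<psi> r \<tau> \<sigma>max L \<eta> a
    by unfold_locales fact+
  have c: "c = a / 2 - \<tau>"
    using \<open>c = 1 / 2 * a - \<tau>\<close> by simp
  have bdd: "bdd_above (range (\<lambda>k. norm (s k)))"
    using norm_step_attains_max by (auto intro: bdd_aboveI)
  have T_max: "\<exists>k. T = norm (s k) \<and> (\<forall>j. norm (s j) \<le> T)"
  proof -
    obtain k where k: "\<And>j. norm (s j) \<le> norm (s k)"
      using norm_step_attains_max by blast
    have "T = norm (s k)"
      unfolding \<open>T = (SUP k. norm (s k))\<close>
      by (intro antisym cSUP_least cSUP_upper2[OF bdd]) (auto intro: k)
    then show ?thesis
      using k by blast
  qed
  show ?thesis
  proof (intro conjI allI impI)
    fix b \<psi>' \<epsilon>' z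
    assume b: "\<forall>k. opnorm (Q k) \<le> b"
      and fejer: "quasi_fejer (limit_sublevel f x) Q x \<psi>' \<epsilon>'"
      and z: "minimizer f z"
    have z_lim: "z \<in> limit_sublevel f x"
      by (rule minimizer_in_limit_sublevel[OF z])
    have "fmin = f z"
      unfolding \<open>fmin = (INF y. f y)\<close>
      using z by (intro cInf_eq_minimum) (auto simp: minimizer_def)
    moreover have "norm (s k) \<le> T" for k
      using T_max by blast
    moreover have "convergent_prod (\<lambda>j. 1 + \<psi>' j)"
      using fejer by (intro convergent_prod_one_plus) (auto simp: quasi_fejer_def)
    ultimately show "let R = radius a Q x z \<psi>' \<epsilon>';
              \<nu> = \<eta> * c / (\<tau> + b + \<sigma>max * T powr (r - 2))\<^sup>2
          in z \<in> limit_sublevel f x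
             \<and> convergent_prod (\<lambda>j. 1 + \<psi>' j)
             \<and> \<nu> > 0
             \<and> (\<forall>k\<ge>1. f (x k) - fmin
                   \<le> R\<^sup>2 * (f (x 0) - fmin) / (R\<^sup>2 + \<nu> * real k * (f (x 0) - fmin)))"
      using b z z_lim distance_le_radius[OF fejer z_lim] sublinear_rate[of b T z]
      unfolding Let_def c by blast
  qed (use c a_gt opnorm_Q_bounded T_max convergent_f ex_quasi_fejer in simp_all)
qed

end
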